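(* Let $G$ be a graph, $B$ a PSD forcing set of $G$ of size $k$, and $\mathcal F$ a propagating family of PSD forces for $B$ on $G$. Let $\mathcal H$ be the collection of subgraphs $H$ of $G$ such that $H=G\left[\bigcup_{P\in\mathcal Q}V(P)\right]$ for some path bundle $\mathcal Q$ of $\mathcal F$ induced by some $x\in V(G)$. Then $$\max_{H\in\mathcal H}\operatorname{pt}(H,B)\le\operatorname{pt}_+(G,B).$$ Moreover, if $\mathcal H'\subseteq\mathcal H$ is the collection of those $H$ arising from path bundles of $\mathcal F$ induced by vertices $x\in B^{(\operatorname{pt}_+(G,B))}$, then $$\operatorname{pt}_+(G,B)\le\min_{H\in\mathcal H'}|V(H)|-k.$$
   Context: All graphs are finite, simple and undirected. Each vertex is blue or white. Standard rule: a blue vertex $u$ with exactly one white neighbor $v$ can force $v$ to become blue. PSD rule: if $B$ is the current set of blue vertices, $C$ is a component of $G-B$, and $u\in B$ satisfies $N_G(u)\cap V(C)=\{v\}$, then $u$ can force $v$ to become blue ($u\to v$). For either rule and initial blue set $B$, put $B^{[0]}=B^{(0)}=B$; for $k\ge1$, $B^{(k)}$ is the set of all white vertices that can be forced when exactly $B^{[k-1]}$ is blue, and $B^{[k]}=B^{[k-1]}\cup B^{(k)}$. $B$ is a standard zero forcing set (resp. PSD forcing set) if $B^{[k]}=V(G)$ for some $k$; the least such $k$ is $\operatorname{pt}(G,B)$ (resp. $\operatorname{pt}_+(G,B)$). In the claim, $B^{(k)}$ refers to the PSD rule in $G$. A propagating family of PSD forces for $B$ is a family $\mathcal F=\{F^{(k)}\}_{k=1}^{t}$,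 $t=\operatorname{pt}_+(G,B)$, where $F^{(k)}$ contains, for each $u\in B^{(k)}$, exactly one force $v_u\to u$ with $v_u\in B^{[k-1]}$ that is valid when exactly $B^{[k-1]}$ is blue, and no other forces. For $x\in V(G)$, $\operatorname{rd}(x)$ is the unique $k$ with $x\in B^{(k)}$. Path bundle of $\mathcal F$ induced by $x$: for $0\le k\le\operatorname{rd}(x)-1$ let $C_x^k$ be the component of $G-B^{[k]}$ containing $x$. Let $B=\{v_i^0\}_{i=1}^{|B|}$ and let $Q_i^{[0]}$ be the one-vertex path on $v_i^0$. For each $i$, if $v_i^k\to w\in F^{(k+1)}$ for some $w\in V(C_x^k)$, put $v_i^{k+1}=w$ and obtain $Q_i^{[k+1]}$ by appending $w$ to the end of $Q_i^{[k]}$; otherwise put $v_i^{k+1}=v_i^k$ and $Q_i^{[k+1]}=Q_i^{[k]}$. The induced path bundle is $\mathcal Q=\{Q_i^{[\operatorname{rd}(x)]}\}_{i=1}^{|B|}$. *)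

theory Defs
  imports "Graph_Theory.Digraph_Component"
begin

text \<open>
  Finite simple undirected graphs are the symmetric loop-free digraphs without multiple arcs of
  locale \<^locale>\<open>graph\<close>. In such a graph, reachability is symmetric, so the strongly connected
  components are the connected components.
\<close>

type_synonym ('a, 'b) force_rule = "('a, 'b) pre_digraph \<Rightarrow> 'a set \<Rightarrow> 'a \<Rightarrow> 'a \<Rightarrow> bool"

definition nbrs :: "('a, 'b) pre_digraph \<Rightarrow> 'a \<Rightarrow> 'a set" where
  "nbrs G u = {v. u \<rightarrow>\<^bsub>G\<^esub> v}"

definition white_graph :: "('a, 'b) pre_digraph \<Rightarrow> 'a set \<Rightarrow> ('a, 'b) pre_digraph" where
  "white_graph G S = G \<restriction> (verts G - S)"

text \<open>In \<open>std_rule G S u v\<close> and \<open>psd_rule G S u v\<close>, \<open>S\<close> is the set of blue vertices and \<open>u\<close> forces \<open>v\<close>.\<close>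

definition std_rule :: "('a, 'b) force_rule" where
  "std_rule G S u v \<longleftrightarrow> u \<in> S \<and> nbrs G u \<inter> (verts G - S) = {v}"

definition psd_rule :: "('a, 'b) force_rule" where
  "psd_rule G S u v \<longleftrightarrow>
     u \<in> S \<and> (\<exists>C \<in> pre_digraph.sccs (white_graph G S). nbrs G u \<inter> verts C = {v})"

definition forceable :: "('a, 'b) force_rule \<Rightarrow> ('a, 'b) pre_digraph \<Rightarrow> 'a set \<Rightarrow> 'a set" where
  "forceable R G S = {w \<in> verts G - S. \<exists>u. R G S u w}"

text \<open>\<open>blue_upto R G B k\<close> is $B^{[k]}$ and \<open>blue_at R G B k\<close> is $B^{(k)}$.\<close>

primrec blue_upto ::
  "('a, 'b) force_rule \<Rightarrow> ('a, 'b) pre_digraph \<Rightarrow> 'a set \<Rightarrow> nat \<Rightarrow> 'a set" where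
  "blue_upto R G B 0 = B"
| "blue_upto R G B (Suc k) = blue_upto R G B k \<union> forceable R G (blue_upto R G B k)"

primrec blue_at ::
  "('a, 'b) force_rule \<Rightarrow> ('a, 'b) pre_digraph \<Rightarrow> 'a set \<Rightarrow> nat \<Rightarrow> 'a set" where
  "blue_at R G B 0 = B"
| "blue_at R G B (Suc k) = forceable R G (blue_upto R G B k)"

definition forcing_set ::
  "('a, 'b) force_rule \<Rightarrow> ('a, 'b) pre_digraph \<Rightarrow> 'a set \<Rightarrow> bool" where
  "forcing_set R G B \<longleftrightarrow> B \<subseteq> verts G \<and> (\<exists>k. blue_upto R G B k = verts G)"

text \<open>Only meaningful if \<^term>\<open>forcing_set R G B\<close> holds.\<close>

definition prop_time ::
  "('a, 'b) force_rule \<Rightarrow> ('a, 'b) pre_digraph \<Rightarrow> 'a set \<Rightarrow> nat" where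
  "prop_time R G B = (LEAST k. blue_upto R G B k = verts G)"

abbreviation "std_forcing_set \<equiv> forcing_set std_rule"
abbreviation "psd_forcing_set \<equiv> forcing_set psd_rule"
abbreviation "pt \<equiv> prop_time std_rule"
abbreviation "pt_plus \<equiv> prop_time psd_rule"

text \<open>
  A force $v \to u$ is the pair \<open>(v, u)\<close>. A family is indexed by $1, \dots, \mathrm{pt}_+(G,B)$;
  the values of \<open>F\<close> at other indices are unconstrained and never used.
\<close>

definition propagating_family ::
  "('a, 'b) pre_digraph \<Rightarrow> 'a set \<Rightarrow> (nat \<Rightarrow> ('a \<times> 'a) set) \<Rightarrow> bool" where
  "propagating_family G B F \<longleftrightarrow>
     (\<forall>k \<in> {1..pt_plus G B}.
        (\<forall>u \<in> blue_at psd_rule G B k. \<exists>!v. (v, u) \<in> F k) \<and>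
        (\<forall>(v, u) \<in> F k. u \<in> blue_at psd_rule G B k \<and> v \<in> blue_upto psd_rule G B (k - 1) \<and>
           psd_rule G (blue_upto psd_rule G B (k - 1)) v u))"

definition rd :: "('a, 'b) pre_digraph \<Rightarrow> 'a set \<Rightarrow> 'a \<Rightarrow> nat" where
  "rd G B x = (THE k. x \<in> blue_at psd_rule G B k)"

text \<open>$V(C_x^k)$\<close>

definition comp_at :: "('a, 'b) pre_digraph \<Rightarrow> 'a set \<Rightarrow> 'a \<Rightarrow> nat \<Rightarrow> 'a set" where
  "comp_at G B x k = pre_digraph.scc_of (white_graph G (blue_upto psd_rule G B k)) x"

text \<open>
  The paths $Q_i^{[k]}$ are indexed by their initial vertices $b = v_i^0$ and given as lists of
  vertices in path order, so $v_i^k$ is the last element of $Q_i^{[k]}$. The description is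
  unique, since a PSD force $v \to w$ into $C_x^k$ requires $w$ to be the only neighbor of $v$
  in $C_x^k$.
\<close>

primrec bundle_path ::
  "('a, 'b) pre_digraph \<Rightarrow> 'a set \<Rightarrow> (nat \<Rightarrow> ('a \<times> 'a) set) \<Rightarrow> 'a \<Rightarrow> 'a \<Rightarrow> nat \<Rightarrow> 'a list" where
  "bundle_path G B F x b 0 = [b]"
| "bundle_path G B F x b (Suc k) =
     (let Q = bundle_path G B F x b k; v = last Q in
      if \<exists>w \<in> comp_at G B x k. (v, w) \<in> F (Suc k)
      then Q @ [THE w. w \<in> comp_at G B x k \<and> (v, w) \<in> F (Suc k)]
      else Q)"

definition path_bundle ::
  "('a, 'b) pre_digraph \<Rightarrow> 'a set \<Rightarrow> (nat \<Rightarrow> ('a \<times> 'a) set) \<Rightarrow> 'a \<Rightarrow> 'a list set" where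
  "path_bundle G B F x = (\<lambda>b. bundle_path G B F x b (rd G B x)) ` B"

definition bundle_subgraph ::
  "('a, 'b) pre_digraph \<Rightarrow> 'a set \<Rightarrow> (nat \<Rightarrow> ('a \<times> 'a) set) \<Rightarrow> 'a \<Rightarrow> ('a, 'b) pre_digraph" where
  "bundle_subgraph G B F x = G \<restriction> (\<Union>P \<in> path_bundle G B F x. set P)"

end

theory Submission
  imports Defs
begin

text \<open>
  Fix a vertex x, let r = rd(x), let C(k) be the component of x among the vertices that are white
  after k steps, and let V(k) consist of the vertices of the paths $Q_i^{[k]}$. The components
  shrink with k, and V(k+1) - V(k) lies in C(k).

  Upper bound: a force u \<rightarrow> w used at step k + 1 has w as its only neighbour in C(k), and every
  vertex of V(r) outside V(k) lies in C(k). By induction V(k) is therefore blue after k steps of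
  standard forcing in G[V(r)].

  Lower bound: each step k + 1 \<le> r adds a vertex to V(k). If no vertex of C(k) were forced at that
  step, none would ever be, but x is. And every blue vertex adjacent to C(k) is the current end of
  one of the paths, so the force into C(k) does extend a path.
\<close>

section \<open>Components of the white graph\<close>

context sym_digraph
begin

text \<open>Reachability in the white graph starts at white vertices only, so the set is empty when
  \<open>x\<close> is blue. Hence the base case of \<open>white_comp_induct\<close> may assume that
  \<open>x\<close> is white.\<close>

abbreviation white_comp :: "'a set \<Rightarrow> 'a \<Rightarrow> 'a set" where
  "white_comp S x \<equiv> pre_digraph.scc_of (white_graph G S) x"

lemma nbrs_sym: "v \<in> nbrs G u \<longleftrightarrow> u \<in> nbrs G v"
  unfolding nbrs_def using graph_symmetric by blast

lemma nbrs_in_verts: "v \<in> nbrs G u \<Longrightarrow> v \<in> verts G"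
  unfolding nbrs_def by (auto simp: adj_in_verts)

lemma dominates_induce_iff: "u \<rightarrow>\<^bsub>G \<restriction> S\<^esub> v \<longleftrightarrow> u \<in> S \<and> v \<in> S \<and> v \<in> nbrs G u"
  unfolding nbrs_def arcs_ends_conv by auto

lemma nbrs_induce: "u \<in> S \<Longrightarrow> nbrs (G \<restriction> S) u = nbrs G u \<inter> S"
  by (auto simp: nbrs_def[of "G \<restriction> S"] dominates_induce_iff)

lemma verts_white_graph [simp]: "verts (white_graph G S) = verts G - S"
  by (simp add: white_graph_def)

lemma dominates_white_graph_iff:
  "u \<rightarrow>\<^bsub>white_graph G S\<^esub> v \<longleftrightarrow> u \<in> verts G - S \<and> v \<in> verts G - S \<and> v \<in> nbrs G u"
  by (simp add: white_graph_def dominates_induce_iff)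

lemma sym_digraph_white_graph: "sym_digraph (white_graph G S)"
proof -
  interpret W: wf_digraph "white_graph G S"
    unfolding white_graph_def by (rule wellformed_induce_subgraph)
  have "symmetric (white_graph G S)"
    unfolding symmetric_def sym_def using nbrs_sym by (auto simp: dominates_white_graph_iff)
  then show ?thesis by (rule W.sym_digraphI)
qed

lemma white_comp_reachable: "y \<in> white_comp S x \<longleftrightarrow> x \<rightarrow>\<^sup>*\<^bsub>white_graph G S\<^esub> y"
proof -
  interpret W: sym_digraph "white_graph G S" by (rule sym_digraph_white_graph)
  show ?thesis using W.scc_ofI_reachable' by (auto simp: W.scc_of_def)
qed

lemma white_comp_white: "white_comp S x \<subseteq> verts G - S"
proof
  fix y assume "y \<in> white_comp S x"
  then have "x \<rightarrow>\<^sup>*\<^bsub>white_graph G S\<^esub> y" by (simp add: white_comp_reachable)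
  then show "y \<in> verts G - S" by (rule reachable_in_vertsE) auto
qed

lemma white_comp_refl: "x \<in> verts G - S \<Longrightarrow> x \<in> white_comp S x"
  using wf_digraph.in_scc_of_self[OF sym_digraph.axioms(1)[OF sym_digraph_white_graph]] by auto

lemma white_comp_eq: "y \<in> white_comp S x \<Longrightarrow> white_comp S y = white_comp S x"
  by (rule wf_digraph.scc_of_eq[OF sym_digraph.axioms(1)[OF sym_digraph_white_graph]])

lemma white_comp_step:
  assumes "y \<in> white_comp S x" "z \<in> nbrs G y" "z \<notin> S"
  shows "z \<in> white_comp S x"
proof -
  interpret W: sym_digraph "white_graph G S" by (rule sym_digraph_white_graph)
  have "y \<rightarrow>\<^bsub>white_graph G S\<^esub> z"
    using assms white_comp_white nbrs_in_verts by (auto simp: dominates_white_graph_iff)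
  then show ?thesis
    using assms(1) W.reachable_adj_trans by (auto simp: white_comp_reachable)
qed

lemma white_comp_induct [consumes 1, case_names base step]:
  assumes "y \<in> white_comp S x" and "x \<in> verts G - S \<Longrightarrow> P x"
    and "\<And>y z. y \<in> white_comp S x \<Longrightarrow> z \<in> nbrs G y \<Longrightarrow> z \<in> verts G - S \<Longrightarrow> P y \<Longrightarrow> P z"
  shows "P y"
proof -
  interpret W: sym_digraph "white_graph G S" by (rule sym_digraph_white_graph)
  have "x \<rightarrow>\<^sup>*\<^bsub>white_graph G S\<^esub> y" using assms(1) by (simp add: white_comp_reachable)
  then show ?thesis
    by (induction rule: W.reachable_induct)
      (use assms(2,3) in \<open>auto simp: white_comp_reachable dominates_white_graph_iff\<close>)
qed

lemma white_comp_antimono: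
  assumes "S \<subseteq> T" shows "white_comp T x \<subseteq> white_comp S x"
proof
  fix y assume "y \<in> white_comp T x"
  then show "y \<in> white_comp S x"
    by (induction rule: white_comp_induct) (use assms white_comp_refl white_comp_step in blast)+
qed

text \<open>Every path from \<open>x\<close> inside its component avoids the newly blue vertices, so
  it survives in the smaller white graph.\<close>

lemma white_comp_eq_if_disjoint:
  assumes "S \<subseteq> T" and "white_comp S x \<inter> T = {}"
  shows "white_comp T x = white_comp S x"
proof
  show "white_comp S x \<subseteq> white_comp T x"
  proof
    fix y assume "y \<in> white_comp S x"
    then show "y \<in> white_comp T x"
    proof (induction rule: white_comp_induct)
      case base
      then show ?case using assms(2) white_comp_refl by blast
    next
      case (step y z)
      then have "z \<in> white_comp S x" using white_comp_step by blast
      then show ?case using step assms(2) white_comp_step by blast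
    qed
  qed
qed (rule white_comp_antimono[OF assms(1)])

text \<open>A component meeting the neighbourhood of \<open>u\<close> exactly in \<open>v\<close>
  contains \<open>v\<close>, so the existential over components can be replaced by the component of
  the forced vertex.\<close>

lemma psd_rule_iff:
  "psd_rule G S u v \<longleftrightarrow> u \<in> S \<and> v \<in> verts G - S \<and> nbrs G u \<inter> white_comp S v = {v}"
proof -
  interpret W: sym_digraph "white_graph G S" by (rule sym_digraph_white_graph)
  have "(\<exists>C \<in> W.sccs. nbrs G u \<inter> verts C = {v}) \<longleftrightarrow>
      (\<exists>C \<in> verts ` W.sccs. nbrs G u \<inter> C = {v})"
    by simp
  also have "\<dots> \<longleftrightarrow> (\<exists>w \<in> verts G - S. nbrs G u \<inter> white_comp S w = {v})"
    by (simp flip: W.sccs_verts_conv add: W.sccs_verts_conv_scc_of)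
  also have "\<dots> \<longleftrightarrow> v \<in> verts G - S \<and> nbrs G u \<inter> white_comp S v = {v}"
    using white_comp_eq white_comp_white by blast
  finally show ?thesis by (simp add: psd_rule_def)
qed

end

section \<open>The chronology of forcing\<close>

lemma blue_upto_mono: "i \<le> j \<Longrightarrow> blue_upto R G B i \<subseteq> blue_upto R G B j"
  by (rule lift_Suc_mono_le) auto

lemma blue_upto_subset_verts: "B \<subseteq> verts G \<Longrightarrow> blue_upto R G B n \<subseteq> verts G"
  by (induction n) (auto simp: forceable_def)

lemma blue_at_subset_blue_upto: "blue_at R G B k \<subseteq> blue_upto R G B k"
  by (cases k) auto

lemma blue_at_if_blue_upto: "x \<in> blue_upto R G B n \<Longrightarrow> \<exists>k\<le>n. x \<in> blue_at R G B k"
proof (induction n)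
  case (Suc n)
  then show ?case
    by (cases "x \<in> blue_upto R G B n") (auto intro: le_SucI exI[of _ "Suc n"])
qed auto

lemma blue_at_imp_not_blue_upto:
  assumes "x \<in> blue_at R G B l" "k < l" shows "x \<notin> blue_upto R G B k"
proof -
  obtain m where "l = Suc m" "k \<le> m" using assms(2) by (cases l) auto
  then show ?thesis using assms(1) blue_upto_mono[of k m R G B] by (auto simp: forceable_def)
qed

text \<open>With different indices the vertex would be blue before the step that first turns it
  blue. This justifies the definite description in \<open>rd\<close>.\<close>

lemma blue_at_unique:
  assumes "x \<in> blue_at R G B k" "x \<in> blue_at R G B l" shows "k = l"
  using blue_at_imp_not_blue_upto[OF assms(1), of l] blue_at_imp_not_blue_upto[OF assms(2), of k]
    subsetD[OF blue_at_subset_blue_upto assms(1)] subsetD[OF blue_at_subset_blue_upto assms(2)]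
  by (meson linorder_neqE_nat)

lemma rd_eq: "x \<in> blue_at psd_rule G B k \<Longrightarrow> rd G B x = k"
  unfolding rd_def by (rule the_equality) (auto dest: blue_at_unique)

lemma blue_upto_prop_time:
  assumes "forcing_set R G B" shows "blue_upto R G B (prop_time R G B) = verts G"
  using assms unfolding forcing_set_def prop_time_def by (elim conjE) (rule LeastI_ex)

text \<open>By minimality of the propagation time its last step is not idle; at time 0 the last
  layer is \<open>B\<close>, which is then all of \<open>verts G\<close>.\<close>

lemma blue_at_prop_time_nonempty:
  assumes "forcing_set R G B" "verts G \<noteq> {}"
  shows "blue_at R G B (prop_time R G B) \<noteq> {}"
proof (cases "prop_time R G B")
  case 0
  then show ?thesis using blue_upto_prop_time[OF assms(1)] assms(2) by simp
next
  case (Suc m)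
  have "blue_upto R G B m \<noteq> verts G"
    using not_less_Least[of m "\<lambda>k. blue_upto R G B k = verts G"] Suc
    by (auto simp: prop_time_def)
  then show ?thesis using blue_upto_prop_time[OF assms(1)] Suc by auto
qed

section \<open>Path bundles\<close>

locale psd_propagation = graph G
  for G :: "('a, 'b) pre_digraph" (structure) +
  fixes B :: "'a set" and F :: "nat \<Rightarrow> ('a \<times> 'a) set"
  assumes forcing: "psd_forcing_set G B"
    and family: "propagating_family G B F"
begin

abbreviation blue :: "nat \<Rightarrow> 'a set" where "blue \<equiv> blue_upto psd_rule G B"

text \<open>This is V(k). The stage is a free parameter to allow induction; at
  \<open>rd G B x\<close> it gives the vertex set of the bundle subgraph.\<close>

definition bundle_verts :: "'a \<Rightarrow> nat \<Rightarrow> 'a set" where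
  "bundle_verts x k = (\<Union>b \<in> B. set (bundle_path G B F x b k))"

lemma blue_Suc_iff:
  "w \<in> blue (Suc k) \<longleftrightarrow> w \<in> blue k \<or> (\<exists>u. psd_rule G (blue k) u w)"
  by (auto simp: forceable_def psd_rule_iff)

lemma rd_le: "x \<in> verts G \<Longrightarrow> rd G B x \<le> pt_plus G B"
  and blue_rd: "x \<in> verts G \<Longrightarrow> x \<in> blue (rd G B x)"
  and not_blue_before_rd: "x \<in> verts G \<Longrightarrow> k < rd G B x \<Longrightarrow> x \<notin> blue k"
proof -
  assume "x \<in> verts G"
  then obtain l where l: "l \<le> pt_plus G B" "x \<in> blue_at psd_rule G B l"
    using blue_upto_prop_time[OF forcing] blue_at_if_blue_upto by metis
  then have "rd G B x = l" by (simp add: rd_eq)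
  then show "rd G B x \<le> pt_plus G B" "x \<in> blue (rd G B x)"
    and "k < rd G B x \<Longrightarrow> x \<notin> blue k"
    using l blue_at_subset_blue_upto blue_at_imp_not_blue_upto by fast+
qed

text \<open>The bound on \<open>k\<close> keeps the index \<open>Suc k\<close> in the range where
  \<open>F\<close> is constrained; it recurs below for this reason.\<close>

lemma family_psd_rule:
  assumes "(v, w) \<in> F (Suc k)" "k < pt_plus G B" shows "psd_rule G (blue k) v w"
proof -
  have "Suc k \<in> {1..pt_plus G B}" using assms(2) by simp
  then show ?thesis using assms(1) family unfolding propagating_family_def by fastforce
qed

lemma family_forcer:
  assumes "w \<in> blue (Suc k)" "w \<notin> blue k" "k < pt_plus G B"
  obtains v where "(v, w) \<in> F (Suc k)"
proof -
  have "Suc k \<in> {1..pt_plus G B}" using assms(3) by simp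
  moreover have "w \<in> blue_at psd_rule G B (Suc k)" using assms by simp
  ultimately show thesis using family that unfolding propagating_family_def by blast
qed

text \<open>The rule refers to the component of \<open>w\<close>, which is C(k) because
  \<open>w\<close> lies in C(k).\<close>

lemma force_into_comp:
  assumes "(v, w) \<in> F (Suc k)" "w \<in> comp_at G B x k" "k < pt_plus G B"
  shows "v \<in> blue k" "nbrs G v \<inter> comp_at G B x k = {w}"
  using family_psd_rule[OF assms(1,3)] white_comp_eq[OF assms(2)[unfolded comp_at_def]]
  by (auto simp: psd_rule_iff comp_at_def)

text \<open>Two forces from the same path end into C(k) would both hit its only neighbour there, so
  \<open>THE\<close> in \<open>bundle_path\<close> picks \<open>w\<close>.\<close>

lemma bundle_path_extend:
  assumes "(last (bundle_path G B F x b k), w) \<in> F (Suc k)" "w \<in> comp_at G B x k"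
    and "k < pt_plus G B"
  shows "bundle_path G B F x b (Suc k) = bundle_path G B F x b k @ [w]"
proof -
  let ?v = "last (bundle_path G B F x b k)"
  have "w' = w" if "w' \<in> comp_at G B x k \<and> (?v, w') \<in> F (Suc k)" for w'
    using force_into_comp(2)[OF assms] force_into_comp(2)[of ?v w' k x] that assms(3) by auto
  then have "(THE w'. w' \<in> comp_at G B x k \<and> (?v, w') \<in> F (Suc k)) = w"
    using assms by blast
  then show ?thesis using assms by (auto simp: Let_def)
qed

lemma bundle_path_stay:
  assumes "\<And>w. w \<in> comp_at G B x k \<Longrightarrow> (last (bundle_path G B F x b k), w) \<notin> F (Suc k)"
  shows "bundle_path G B F x b (Suc k) = bundle_path G B F x b k"
  using assms by (auto simp: Let_def)

lemma bundle_path_nonempty: "bundle_path G B F x b k \<noteq> []"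
  by (induction k) (auto simp: Let_def)

lemma bundle_verts_0: "bundle_verts x 0 = B"
  by (simp add: bundle_verts_def)

lemma bundle_verts_Suc_subset: "bundle_verts x k \<subseteq> bundle_verts x (Suc k)"
  by (auto simp: bundle_verts_def Let_def)

lemma bundle_verts_new:
  assumes "w \<in> bundle_verts x (Suc k)" "w \<notin> bundle_verts x k" "k < pt_plus G B"
  obtains v where "v \<in> bundle_verts x k" "(v, w) \<in> F (Suc k)" "w \<in> comp_at G B x k"
proof -
  obtain b where b: "b \<in> B" "w \<in> set (bundle_path G B F x b (Suc k))"
    using assms(1) by (auto simp: bundle_verts_def)
  let ?Q = "bundle_path G B F x b k"
  have w: "w \<notin> set ?Q" using assms(2) b(1) by (auto simp: bundle_verts_def)
  obtain w' where w': "w' \<in> comp_at G B x k" "(last ?Q, w') \<in> F (Suc k)"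
    using bundle_path_stay b(2) w by metis
  have "w = w'" using bundle_path_extend[OF w'(2,1) assms(3)] b(2) w by simp
  moreover have "last ?Q \<in> bundle_verts x k"
    using b(1) last_in_set[OF bundle_path_nonempty] by (auto simp: bundle_verts_def)
  ultimately show thesis using w' that by blast
qed

lemma comp_at_antimono: "i \<le> j \<Longrightarrow> comp_at G B x j \<subseteq> comp_at G B x i"
  unfolding comp_at_def by (intro white_comp_antimono blue_upto_mono)

lemma comp_at_white: "comp_at G B x k \<subseteq> verts G - blue k"
  unfolding comp_at_def by (rule white_comp_white)

text \<open>Vertices appended after stage \<open>k\<close> lie in a later component of
  \<open>x\<close>, which is contained in C(k).\<close>

lemma bundle_verts_subset_comp_at:
  assumes "k \<le> n" "n \<le> pt_plus G B"
  shows "bundle_verts x n \<subseteq> bundle_verts x k \<union> comp_at G B x k"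
  using assms
proof (induction n rule: dec_induct)
  case (step n)
  show ?case
  proof
    fix w assume w: "w \<in> bundle_verts x (Suc n)"
    show "w \<in> bundle_verts x k \<union> comp_at G B x k"
    proof (cases "w \<in> bundle_verts x n")
      case True
      then show ?thesis using step by auto
    next
      case False
      then have "w \<in> comp_at G B x n" using bundle_verts_new[OF w] step.prems by auto
      then show ?thesis using comp_at_antimono[OF \<open>k \<le> n\<close>] by blast
    qed
  qed
qed auto

lemma bundle_verts_subset_blue: "k \<le> pt_plus G B \<Longrightarrow> bundle_verts x k \<subseteq> blue k"
proof (induction k)
  case (Suc k)
  show ?case
  proof
    fix w assume "w \<in> bundle_verts x (Suc k)"
    then show "w \<in> blue (Suc k)"
      using Suc bundle_verts_new[of w x k] family_psd_rule blue_Suc_iff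
      by (metis Suc_le_eq order_less_imp_le subsetD)
  qed
qed (simp add: bundle_verts_0)

lemma bundle_verts_subset_verts: "k \<le> pt_plus G B \<Longrightarrow> bundle_verts x k \<subseteq> verts G"
  using bundle_verts_subset_blue blue_upto_subset_verts forcing
  unfolding forcing_set_def by blast

lemma bundle_subgraph_eq: "bundle_subgraph G B F x = G \<restriction> bundle_verts x (rd G B x)"
  by (simp add: bundle_subgraph_def path_bundle_def bundle_verts_def)

lemma verts_bundle_subgraph: "verts (bundle_subgraph G B F x) = bundle_verts x (rd G B x)"
  by (simp add: bundle_subgraph_eq)

section \<open>Standard forcing in the induced subgraph\<close>

text \<open>The inclusion lets standard forcing run ahead of the paths: extra blue vertices only
  shrink the white set in which \<open>w\<close> must be the unique neighbour of
  \<open>v\<close>.\<close>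

lemma bundle_verts_subset_std_blue:
  assumes "k \<le> n" "n \<le> pt_plus G B"
  shows "bundle_verts x k \<subseteq> blue_upto std_rule (G \<restriction> bundle_verts x n) B k"
  using assms(1)
proof (induction k)
  case 0
  then show ?case by (simp add: bundle_verts_0)
next
  case (Suc k)
  let ?V = "bundle_verts x n" and ?H = "G \<restriction> bundle_verts x n"
  let ?S = "blue_upto std_rule ?H B k"
  have IH: "bundle_verts x k \<subseteq> ?S" using Suc by simp
  have V_mono: "bundle_verts x i \<subseteq> ?V" if "i \<le> n" for i
    using lift_Suc_mono_le[of "bundle_verts x"] bundle_verts_Suc_subset that by blast
  show ?case
  proof
    fix w assume w: "w \<in> bundle_verts x (Suc k)"
    show "w \<in> blue_upto std_rule ?H B (Suc k)"
    proof (cases "w \<in> ?S")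
      case False
      have k: "k < pt_plus G B" using Suc assms by simp
      obtain v where v: "v \<in> bundle_verts x k" "(v, w) \<in> F (Suc k)" "w \<in> comp_at G B x k"
        using bundle_verts_new[OF w] False IH k by blast
      have wV: "w \<in> ?V" and vV: "v \<in> ?V"
        using w v(1) V_mono[of k] V_mono[of "Suc k"] Suc.prems by auto
      have only: "nbrs G v \<inter> comp_at G B x k = {w}" by (rule force_into_comp(2)[OF v(2,3) k])
      \<comment> \<open>A vertex still white in \<open>?H\<close> is outside V(k) by the induction
        hypothesis, so it joins the bundle later and lies in C(k).\<close>
      have "?V - ?S \<subseteq> comp_at G B x k"
        using bundle_verts_subset_comp_at[of k n x] Suc.prems assms(2) IH by auto
      then have "nbrs ?H v \<inter> (?V - ?S) = {w}"
        using only wV False nbrs_induce[OF vV] by blast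
      then have "std_rule ?H ?S v w" using v(1) IH by (auto simp: std_rule_def)
      then show ?thesis using wV False by (auto simp: forceable_def)
    qed simp
  qed
qed

lemma std_blue_rd:
  assumes "x \<in> verts G"
  shows "blue_upto std_rule (bundle_subgraph G B F x) B (rd G B x)
    = verts (bundle_subgraph G B F x)"
proof
  have "B \<subseteq> bundle_verts x n" for n
    using lift_Suc_mono_le[of "bundle_verts x" 0] bundle_verts_Suc_subset bundle_verts_0 by blast
  then show "blue_upto std_rule (bundle_subgraph G B F x) B (rd G B x)
      \<subseteq> verts (bundle_subgraph G B F x)"
    by (intro blue_upto_subset_verts) (simp add: verts_bundle_subgraph)
qed (use bundle_verts_subset_std_blue rd_le[OF assms] in
    \<open>simp add: bundle_subgraph_eq\<close>)

text \<open>This makes \<open>pt\<close> of the subgraph meaningful, since the \<open>LEAST\<close>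
  in it ranges over a nonempty set.\<close>

lemma std_forcing_set_bundle_subgraph:
  assumes "x \<in> verts G" shows "std_forcing_set (bundle_subgraph G B F x) B"
proof -
  have "B \<subseteq> blue_upto std_rule (bundle_subgraph G B F x) B (rd G B x)"
    using blue_upto_mono[of 0] by fastforce
  then show ?thesis using std_blue_rd[OF assms] unfolding forcing_set_def by auto
qed

lemma pt_bundle_subgraph_le:
  assumes "x \<in> verts G" shows "pt (bundle_subgraph G B F x) B \<le> pt_plus G B"
proof -
  have "pt (bundle_subgraph G B F x) B \<le> rd G B x"
    unfolding prop_time_def using std_blue_rd[OF assms] by (rule Least_le)
  then show ?thesis using rd_le[OF assms] by simp
qed

section \<open>Growth of the bundle\<close>

text \<open>Induction on the stage: an old boundary vertex remains the end of its path, and a new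
  one is appended to the path of its forcer.\<close>

lemma blue_boundary_is_path_end:
  assumes "v \<in> blue k" "nbrs G v \<inter> comp_at G B x k \<noteq> {}" "k \<le> pt_plus G B"
  shows "\<exists>b\<in>B. last (bundle_path G B F x b k) = v"
  using assms
proof (induction k arbitrary: v)
  case 0
  then show ?case by simp
next
  case (Suc k)
  have k: "k < pt_plus G B" using Suc.prems by simp
  obtain y where y: "y \<in> nbrs G v" "y \<in> comp_at G B x (Suc k)" using Suc.prems(2) by blast
  have yk: "y \<in> comp_at G B x k" using y(2) comp_at_antimono[of k "Suc k" x] by auto
  show ?case
  proof (cases "v \<in> blue k")
    case True
    then obtain b where b: "b \<in> B" "last (bundle_path G B F x b k) = v"
      using Suc.IH[of v] y(1) yk k by fastforce
    \<comment> \<open>If the path moved on from \<open>v\<close>, it would force the only neighbour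
      of \<open>v\<close> in C(k), namely \<open>y\<close>; but \<open>y\<close> is still white
      afterwards.\<close>
    have "(v, w) \<notin> F (Suc k)" if w: "w \<in> comp_at G B x k" for w
    proof
      assume f: "(v, w) \<in> F (Suc k)"
      then have "y = w" using force_into_comp(2)[OF f w k] y(1) yk by blast
      moreover have "w \<in> blue (Suc k)" using family_psd_rule[OF f k] blue_Suc_iff by blast
      ultimately show False using y(2) comp_at_white by blast
    qed
    then show ?thesis using bundle_path_stay b by metis
  next
    case False
    \<comment> \<open>Being white at stage \<open>k\<close> and adjacent to \<open>y\<close>, the
      vertex \<open>v\<close> belongs to the component of \<open>y\<close>.\<close>
    have v: "v \<in> comp_at G B x k"
      using white_comp_step[of y "blue k" x v] yk y(1) nbrs_sym False
      by (auto simp: comp_at_def)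
    obtain u where u: "(u, v) \<in> F (Suc k)"
      using family_forcer[OF Suc.prems(1) False k] .
    \<comment> \<open>The forcer \<open>u\<close> is blue and has the neighbour \<open>v\<close> in
      C(k), so the induction hypothesis applies to it.\<close>
    obtain b where b: "b \<in> B" "last (bundle_path G B F x b k) = u"
      using Suc.IH[of u] force_into_comp[OF u v k] k by fastforce
    have "last (bundle_path G B F x b (Suc k)) = v"
      using bundle_path_extend[of x b k v] b(2) u v k by simp
    then show ?thesis using b(1) by blast
  qed
qed

text \<open>Forces into a component depend only on the component and its blue neighbours. If one
  step leaves C(k) untouched, neither changes, so every later step does as well.\<close>

lemma comp_stalled:
  assumes "k \<le> j" "comp_at G B x k \<inter> blue (Suc k) = {}"
  shows "comp_at G B x k \<inter> blue j = {}"
  using assms(1)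
proof (induction j rule: dec_induct)
  case base
  then show ?case using comp_at_white by blast
next
  case (step j)
  have eq: "white_comp (blue j) x = white_comp (blue k) x"
    using white_comp_eq_if_disjoint[OF blue_upto_mono[OF step.hyps(1)]] step.IH
    by (simp add: comp_at_def)
  have "w \<notin> blue (Suc j)" if w: "w \<in> comp_at G B x k" for w
  proof
    assume "w \<in> blue (Suc j)"
    then obtain v where v: "psd_rule G (blue j) v w" using step.IH w blue_Suc_iff by blast
    then have vj: "v \<in> blue j"
      and only: "nbrs G v \<inter> white_comp (blue j) w = {w}"
      by (auto simp: psd_rule_iff)
    have comps: "white_comp (blue j) w = comp_at G B x k"
      "white_comp (blue k) w = comp_at G B x k"
      using w eq white_comp_eq[of w] by (auto simp: comp_at_def)
    \<comment> \<open>A neighbour of C(k) that is white at stage \<open>k\<close> lies in C(k),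
      which has no blue vertex at stage \<open>j\<close>.\<close>
    have "v \<in> blue k"
    proof (rule ccontr)
      assume "v \<notin> blue k"
      moreover have "v \<in> nbrs G w" using only nbrs_sym by blast
      ultimately have "v \<in> comp_at G B x k"
        using w white_comp_step by (auto simp: comp_at_def)
      then show False using vj step.IH by blast
    qed
    then have "psd_rule G (blue k) v w"
      using only comps w subsetD[OF comp_at_white w] by (auto simp: psd_rule_iff)
    then show False using w assms(2) blue_Suc_iff by blast
  qed
  then show ?case by blast
qed

lemma bundle_verts_grows:
  assumes "x \<in> verts G" "k < rd G B x"
  shows "bundle_verts x k \<subset> bundle_verts x (Suc k)"
proof -
  have k: "k < pt_plus G B" using rd_le[OF assms(1)] assms(2) by simp
  have "x \<in> comp_at G B x k"
    using white_comp_refl not_blue_before_rd[OF assms] assms(1) by (simp add: comp_at_def)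
  \<comment> \<open>Otherwise C(k) would be stalled and \<open>x\<close> would still be white at
    time \<open>rd G B x\<close>.\<close>
  then have "comp_at G B x k \<inter> blue (Suc k) \<noteq> {}"
    using comp_stalled[of k "rd G B x" x] assms blue_rd by fastforce
  then obtain w where w: "w \<in> comp_at G B x k" "w \<in> blue (Suc k)" by blast
  have wk: "w \<notin> blue k" using w(1) comp_at_white by blast
  obtain u where u: "(u, w) \<in> F (Suc k)" using family_forcer[OF w(2) wk k] .
  obtain b where b: "b \<in> B" "last (bundle_path G B F x b k) = u"
    using blue_boundary_is_path_end force_into_comp[OF u w(1) k] k by fastforce
  have "bundle_path G B F x b (Suc k) = bundle_path G B F x b k @ [w]"
    using bundle_path_extend b(2) u w(1) k by blast
  then have "w \<in> set (bundle_path G B F x b (Suc k))" by simp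
  then have "w \<in> bundle_verts x (Suc k)" unfolding bundle_verts_def using b(1) by blast
  moreover have "w \<notin> bundle_verts x k" using wk bundle_verts_subset_blue[of k x] k by auto
  ultimately show ?thesis using bundle_verts_Suc_subset by blast
qed

lemma rd_le_card_bundle_subgraph:
  assumes "x \<in> verts G"
  shows "rd G B x + card B \<le> card (verts (bundle_subgraph G B F x))"
proof -
  have "k + card B \<le> card (bundle_verts x k)" if "k \<le> rd G B x" for k
    using that
  proof (induction k)
    case (Suc k)
    have "finite (bundle_verts x (Suc k))"
      using bundle_verts_subset_verts Suc.prems rd_le[OF assms] finite_verts
      by (meson finite_subset order_trans)
    then have "card (bundle_verts x k) < card (bundle_verts x (Suc k))"
      using bundle_verts_grows[OF assms] Suc.prems by (simp add: psubset_card_mono)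
    then show ?case using Suc by simp
  qed (simp add: bundle_verts_0)
  then show ?thesis by (simp add: verts_bundle_subgraph)
qed

end

section \<open>Passage to the maximum and minimum over the inducing vertices\<close>

theorem corollary5p9:
  fixes G :: "('a, 'b) pre_digraph" and B :: "'a set" and k :: nat
    and F :: "nat \<Rightarrow> ('a \<times> 'a) set" and \<H> \<H>' :: "('a, 'b) pre_digraph set"
  assumes "graph G" and "verts G \<noteq> {}"
    and "psd_forcing_set G B" and "card B = k"
    and "propagating_family G B F"
    and "\<H> = {bundle_subgraph G B F x | x. x \<in> verts G}"
    and "\<H>' = {bundle_subgraph G B F x | x. x \<in> blue_at psd_rule G B (pt_plus G B)}"
  shows "(\<forall>H \<in> \<H>. std_forcing_set H B) \<and>
    (MAX H \<in> \<H>. pt H B) \<le> pt_plus G B \<and>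
    int (pt_plus G B) \<le> int (MIN H \<in> \<H>'. card (verts H)) - int k"
proof -
  interpret psd_propagation G B F
    using assms(1,3,5) by (intro psd_propagation.intro psd_propagation_axioms.intro)
  let ?T = "blue_at psd_rule G B (pt_plus G B)"
  have T: "?T \<subseteq> verts G" "?T \<noteq> {}"
    using blue_at_subset_blue_upto[of psd_rule G B "pt_plus G B"]
      blue_upto_prop_time[OF forcing] blue_at_prop_time_nonempty[OF forcing assms(2)] by auto
  have \<H>: "\<H> = bundle_subgraph G B F ` verts G" and \<H>': "\<H>' = bundle_subgraph G B F ` ?T"
    using assms(6,7) by auto
  \<comment> \<open>Bounds on \<open>MAX\<close> and \<open>MIN\<close> require finite nonempty
    families; the second family is nonempty because the last layer is.\<close>
  have fin: "finite \<H>" "\<H> \<noteq> {}" "finite \<H>'" "\<H>' \<noteq> {}"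
    using \<H> \<H>' T assms(2) finite_subset[OF T(1)] by auto
  have "(MAX H \<in> \<H>. pt H B) \<le> pt_plus G B"
    using fin pt_bundle_subgraph_le by (auto simp: \<H>)
  \<comment> \<open>The additive form avoids truncated subtraction on naturals; the integer
    difference follows from it at the end.\<close>
  moreover have "pt_plus G B + k \<le> (MIN H \<in> \<H>'. card (verts H))"
  proof (rule Min.boundedI)
    fix m assume "m \<in> (\<lambda>H. card (verts H)) ` \<H>'"
    then obtain x where "x \<in> ?T" "m = card (verts (bundle_subgraph G B F x))"
      by (auto simp: \<H>')
    \<comment> \<open>A vertex of the last layer has \<open>rd G B x = pt_plus G B\<close>.\<close>
    then show "pt_plus G B + k \<le> m"
      using rd_le_card_bundle_subgraph[of x] rd_eq[of x G B] T(1) assms(4) by auto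
  qed (use fin in auto)
  moreover have "\<forall>H \<in> \<H>. std_forcing_set H B"
    using std_forcing_set_bundle_subgraph by (auto simp: \<H>)
  ultimately show ?thesis by linarith
qed

end
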